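(* Let $H$ be a skew Hadamard matrix of order $4u$. Then there exists a directed Deza graph with parameters $(8u,4u-1,4u-1,2u-1,0)$.
   Context: A Hadamard matrix of order $n$ is an $n\times n$ $(1,-1)$-matrix $H$ with $HH^t=nI_n$; it is skew (skew-type) if $H+H^t=2I_n$. Digraphs have no loops and at most one arc from one vertex to another. Write $u\rightarrow v$ if there is an arc from $u$ to $v$. Two vertices $u,v$ are called adjacent if $u\rightarrow v$ and $v\rightarrow u$. Let $n,k,b,a,t$ be integers with $0\le a\le b\le k\le n$ and $0\le t\le k$. A digraph $D=(V,A)$ is a directed Deza graph with parameters $(n,k,b,a,t)$ if: (1) $|V|=n$; (2) every vertex has in-degree and out-degree $k$ and is adjacent to exactly $t$ vertices; (3) for any distinct vertices $u,v$, the number of vertices $w$ with $u\rightarrow w\rightarrow v$ is $a$ or $b$. *)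

theory Defs
  imports "Jordan_Normal_Form.Matrix" "Graph_Theory.Digraph"
begin

definition hadamard_matrix :: "nat \<Rightarrow> int mat \<Rightarrow> bool" where
  "hadamard_matrix n H \<longleftrightarrow>
     H \<in> carrier_mat n n \<and> elements_mat H \<subseteq> {1, -1} \<and>
     H * transpose_mat H = of_nat n \<cdot>\<^sub>m 1\<^sub>m n"

definition skew_hadamard_matrix :: "nat \<Rightarrow> int mat \<Rightarrow> bool" where
  "skew_hadamard_matrix n H \<longleftrightarrow>
     hadamard_matrix n H \<and> H + transpose_mat H = 2 \<cdot>\<^sub>m 1\<^sub>m n"

text \<open>Adjacency of two vertices means that there are arcs in both directions; opposite
  arcs are not excluded by the locale \<^locale>\<open>digraph\<close>, which only rules out loops and
  several arcs with the same tail and head.\<close>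

definition adjacent :: "('a, 'b) pre_digraph \<Rightarrow> 'a \<Rightarrow> 'a \<Rightarrow> bool" where
  "adjacent D x y \<longleftrightarrow> x \<rightarrow>\<^bsub>D\<^esub> y \<and> y \<rightarrow>\<^bsub>D\<^esub> x"

locale directed_deza_graph = digraph D
  for D :: "('a, 'b) pre_digraph" (structure) and n k b a t :: nat +
  assumes params: "a \<le> b" "b \<le> k" "k \<le> n" "t \<le> k"
    and card_verts: "card (verts D) = n"
    and in_degree: "\<And>x. x \<in> verts D \<Longrightarrow> in_degree D x = k"
    and out_degree: "\<And>x. x \<in> verts D \<Longrightarrow> out_degree D x = k"
    and card_adjacent: "\<And>x. x \<in> verts D \<Longrightarrow> card {y \<in> verts D. adjacent D x y} = t"
    and card_two_paths:
      "\<And>x y. \<lbrakk>x \<in> verts D; y \<in> verts D; x \<noteq> y\<rbrakk> \<Longrightarrow>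
         card {w \<in> verts D. x \<rightarrow> w \<and> w \<rightarrow> y} \<in> {a, b}"

end

(* Off the diagonal, H is a skew matrix of signs.  The digraph is the double cover of this signed
   tournament: its vertices are the pairs (i, e) with a sign e, and (i, e) -> (j, f) iff
   H_ij = e f.  Since H is skew, every 2-path that starts at (i, e) and returns to row i ends at
   (i, -e), so all 4u - 1 out-neighbours of (i, e) are in-neighbours of (i, -e).  A 2-path from
   (i, e) to (j, f) with i ~= j corresponds to a column k different from i, j with
   H_ik H_jk = - e f, and by orthogonality of the rows half of the 4u - 2 columns qualify. *)

theory Submission
  imports Defs
begin

text \<open>The sum is c times the difference between the number of values c and the number of
  values -c, so its vanishing makes the two classes equally large.\<close>

lemma card_sign_eq:
  fixes f :: "'a \<Rightarrow> int"
  assumes fin: "finite K" and sign: "\<And>k. k \<in> K \<Longrightarrow> f k = 1 \<or> f k = -1"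
    and sum: "sum f K = 0" and c: "c = 1 \<or> c = -1"
  shows "2 * card {k \<in> K. f k = c} = card K"
proof -
  let ?A = "{k \<in> K. f k = c}" and ?B = "{k \<in> K. f k \<noteq> c}"
  have K: "K = ?A \<union> ?B" by auto
  have "sum f K = sum f ?A + sum f ?B"
    by (subst K, rule sum.union_disjoint) (use fin in auto)
  moreover have "sum f ?A = sum (\<lambda>_. c) ?A" by (rule sum.cong) auto
  moreover have "sum f ?B = sum (\<lambda>_. - c) ?B" by (rule sum.cong) (use sign c in force)+
  ultimately have "c * int (card ?A) - c * int (card ?B) = 0"
    using sum by simp
  with c have "int (card ?A) - int (card ?B) = 0" by (elim disjE) simp_all
  then have "card ?A = card ?B" by simp
  moreover have "card K = card ?A + card ?B"
    by (subst K, rule card_Un_disjoint) (use fin in auto)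
  ultimately show ?thesis by simp
qed

text \<open>The fibre of \<open>div 2\<close> over k is {2k, 2k+1}, and its two members have
  opposite signs (-1)^w. Prescribing a sign on a fibre therefore selects exactly one vertex, which
  turns every count of vertices below into a count of rows.\<close>

lemma card_section_div2:
  fixes s :: "nat \<Rightarrow> int"
  assumes s: "\<And>k. k < m \<Longrightarrow> P k \<Longrightarrow> s k = 1 \<or> s k = -1"
  shows "card {w. w < 2 * m \<and> P (w div 2) \<and> (-1) ^ w = s (w div 2)} = card {k. k < m \<and> P k}"
    (is "card ?L = card ?R")
proof -
  \<comment> \<open>The selected vertex of the fibre: even for sign 1, odd for sign -1.\<close>
  define g where "g k = 2 * k + (if s k = 1 then 0 else 1)" for k
  have "inj g"
    unfolding g_def inj_def by (auto split: if_splits)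
  moreover have "g ` ?R = ?L"
  proof (intro equalityI subsetI)
    fix w assume "w \<in> g ` ?R"
    then obtain k where "w = g k" "k < m" "P k" by auto
    with s[of k] show "w \<in> ?L" by (auto simp: g_def)
  next
    fix w assume w: "w \<in> ?L"
    then have "w = g (w div 2)"
      by (cases "even w") (auto simp: g_def)
    moreover have "w div 2 \<in> ?R" using w by auto
    ultimately show "w \<in> g ` ?R" by blast
  qed
  ultimately show ?thesis
    using card_image[of g ?R] by (metis inj_on_subset subset_UNIV)
qed

text \<open>Orthogonality is stated without the columns i and j because arcs join distinct rows, so
  the middle vertex of a 2-path lies in neither end row.\<close>

locale skew_orthogonal_signs =
  fixes m :: nat and h :: "nat \<Rightarrow> nat \<Rightarrow> int"
  assumes sign: "\<And>i j. i < m \<Longrightarrow> j < m \<Longrightarrow> h i j = 1 \<or> h i j = -1"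
    and skew: "\<And>i j. i < m \<Longrightarrow> j < m \<Longrightarrow> i \<noteq> j \<Longrightarrow> h j i = - h i j"
    and orthogonal: "\<And>i j. i < m \<Longrightarrow> j < m \<Longrightarrow> i \<noteq> j \<Longrightarrow>
      (\<Sum>k\<in>{..<m} - {i, j}. h i k * h j k) = 0"
begin

(* The vertex x encodes the pair (x div 2, (-1) ^ x). *)
definition arc :: "nat \<Rightarrow> nat \<Rightarrow> bool" where
  "arc x y \<longleftrightarrow> x < 2 * m \<and> y < 2 * m \<and> x div 2 \<noteq> y div 2 \<and> h (x div 2) (y div 2) = (-1) ^ x * (-1) ^ y"

definition cover :: "(nat, nat \<times> nat) pre_digraph" where
  "cover = \<lparr>verts = {..<2 * m}, arcs = {(x, y). arc x y}, tail = fst, head = snd\<rparr>"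

lemma pow_sign: "(-1 :: int) ^ x = 1 \<or> (-1 :: int) ^ x = -1"
  by (cases "even x") auto

text \<open>Signs are their own inverses, so the arc condition can be solved for the sign of w, as
  \<open>card_section_div2\<close> requires.\<close>

lemma arc_iff_tail:
  assumes "x < 2 * m" "w < 2 * m"
  shows "arc x w \<longleftrightarrow> w div 2 \<noteq> x div 2 \<and> (-1) ^ w = (-1) ^ x * h (x div 2) (w div 2)"
  using pow_sign[of x] pow_sign[of w] sign[of "x div 2" "w div 2"] assms
  by (auto simp: arc_def)

text \<open>Skewness moves the entry into row \<open>x div 2\<close>, at the price of a minus sign.
  Both neighbourhoods of x are thus described by the same row of h, with opposite signs.\<close>

lemma arc_iff_head:
  assumes "x < 2 * m" "w < 2 * m"
  shows "arc w x \<longleftrightarrow> w div 2 \<noteq> x div 2 \<and> (-1) ^ w = - ((-1) ^ x) * h (x div 2) (w div 2)"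
proof (cases "w div 2 = x div 2")
  case False
  with assms have "h (w div 2) (x div 2) = - h (x div 2) (w div 2)" by (intro skew) auto
  with False show ?thesis
    using pow_sign[of x] pow_sign[of w] sign[of "x div 2" "w div 2"] assms
    by (auto simp: arc_def)
qed (auto simp: arc_def)

text \<open>Arcs in both directions would demand opposite signs of y. This gives t = 0.\<close>

lemma arc_asym: "arc x y \<Longrightarrow> \<not> arc y x"
  using arc_iff_tail[of x y] arc_iff_head[of x y] pow_sign[of y]
  by (auto simp: arc_def)

lemma card_other_rows: "i < m \<Longrightarrow> card {k. k < m \<and> k \<noteq> i} = m - 1"
proof -
  assume "i < m"
  moreover have "{k. k < m \<and> k \<noteq> i} = {..<m} - {i}" by auto
  ultimately show ?thesis by simp
qed

lemma card_out:
  assumes x: "x < 2 * m"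
  shows "card {w. arc x w} = m - 1"
proof -
  let ?i = "x div 2"
  let ?T = "{w. w < 2 * m \<and> w div 2 \<noteq> ?i \<and> (-1) ^ w = (-1) ^ x * h ?i (w div 2)}"
  have i: "?i < m" using x by auto
  have nbrs: "{w. arc x w} = ?T"
    using arc_iff_tail[OF x] by (auto simp: arc_def)
  have lift: "card ?T = card {k. k < m \<and> k \<noteq> ?i}"
  proof (rule card_section_div2)
    show "(-1) ^ x * h ?i k = 1 \<or> (-1) ^ x * h ?i k = -1" if "k < m" for k
      using sign[OF i that] pow_sign[of x] by (elim disjE) simp_all
  qed
  show ?thesis by (simp only: nbrs lift card_other_rows[OF i])
qed

lemma card_in:
  assumes x: "x < 2 * m"
  shows "card {w. arc w x} = m - 1"
proof -
  let ?i = "x div 2"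
  let ?T = "{w. w < 2 * m \<and> w div 2 \<noteq> ?i \<and> (-1) ^ w = - ((-1) ^ x) * h ?i (w div 2)}"
  have i: "?i < m" using x by auto
  have nbrs: "{w. arc w x} = ?T"
    using arc_iff_head[OF x] by (auto simp: arc_def)
  have lift: "card ?T = card {k. k < m \<and> k \<noteq> ?i}"
  proof (rule card_section_div2)
    show "- ((-1) ^ x) * h ?i k = 1 \<or> - ((-1) ^ x) * h ?i k = -1" if "k < m" for k
      using sign[OF i that] pow_sign[of x] by (elim disjE) simp_all
  qed
  show ?thesis by (simp only: nbrs lift card_other_rows[OF i])
qed

text \<open>The minus sign between out- and in-neighbourhoods is cancelled by the opposite signs of
  x and y, so the out-neighbours of x are the in-neighbours of y.\<close>

lemma card_two_paths_same_row:
  assumes x: "x < 2 * m" and y: "y < 2 * m" and "x \<noteq> y" and row: "x div 2 = y div 2"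
  shows "card {w. arc x w \<and> arc w y} = m - 1"
proof -
  have "even x \<longleftrightarrow> odd y" using \<open>x \<noteq> y\<close> row by presburger
  then have "(-1 :: int) ^ y = - ((-1) ^ x)" by (cases "even x") auto
  then have "arc x w \<longleftrightarrow> arc w y" if "w < 2 * m" for w
    using arc_iff_tail[OF x that] arc_iff_head[OF y that] row by simp
  then have "{w. arc x w \<and> arc w y} = {w. arc x w}" by (auto simp: arc_def)
  then show ?thesis using card_out[OF x] by simp
qed

lemma card_two_paths_distinct_rows:
  assumes x: "x < 2 * m" and y: "y < 2 * m" and row: "x div 2 \<noteq> y div 2"
  shows "card {w. arc x w \<and> arc w y} = m div 2 - 1"
proof -
  let ?i = "x div 2" and ?j = "y div 2"
  \<comment> \<open>A middle vertex w over column k must have sign (-1)^x h i k as a head and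
    -(-1)^y h j k as a tail. These agree exactly when h i k * h j k = c, and then one w lies over
    k.\<close>
  define c :: int where "c = - ((-1) ^ x * (-1) ^ y)"
  have c: "c = 1 \<or> c = -1" using pow_sign[of x] pow_sign[of y] by (auto simp: c_def)
  let ?K = "{..<m} - {?i, ?j}"
  let ?P = "\<lambda>k. k \<noteq> ?i \<and> k \<noteq> ?j \<and> h ?i k * h ?j k = c"
  have i: "?i < m" and j: "?j < m" using x y by auto
  have row_form: "arc x w \<and> arc w y \<longleftrightarrow> ?P (w div 2) \<and> (-1) ^ w = (-1) ^ x * h ?i (w div 2)"
    if w: "w < 2 * m" for w
  proof -
    have "w div 2 < m" using w by auto
    with i j have "h ?i (w div 2) = 1 \<or> h ?i (w div 2) = -1" "h ?j (w div 2) = 1 \<or> h ?j (w div 2) = -1"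
      using sign by blast+
    then have "(-1) ^ w = (-1) ^ x * h ?i (w div 2) \<and> (-1) ^ w = - ((-1) ^ y) * h ?j (w div 2) \<longleftrightarrow>
        h ?i (w div 2) * h ?j (w div 2) = c \<and> (-1) ^ w = (-1) ^ x * h ?i (w div 2)"
      using pow_sign[of x] pow_sign[of y] by (elim disjE) (auto simp: c_def)
    then show ?thesis
      using arc_iff_tail[OF x w] arc_iff_head[OF y w] by blast
  qed
  let ?T = "{w. w < 2 * m \<and> ?P (w div 2) \<and> (-1) ^ w = (-1) ^ x * h ?i (w div 2)}"
  have "{w. arc x w \<and> arc w y} = {w. w < 2 * m \<and> (arc x w \<and> arc w y)}"
    by (auto simp: arc_def)
  also have "\<dots> = ?T"
    by (rule Collect_cong, rule conj_cong[OF refl], rule row_form)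
  finally have paths: "{w. arc x w \<and> arc w y} = ?T" .
  have lift: "card ?T = card {k. k < m \<and> ?P k}"
  proof (rule card_section_div2)
    show "(-1) ^ x * h ?i k = 1 \<or> (-1) ^ x * h ?i k = -1" if "k < m" for k
      using sign[OF i that] pow_sign[of x] by (elim disjE) simp_all
  qed
  have columns: "{k. k < m \<and> ?P k} = {k \<in> ?K. h ?i k * h ?j k = c}" by auto
  have eq: "card {w. arc x w \<and> arc w y} = card {k \<in> ?K. h ?i k * h ?j k = c}"
    by (simp only: paths lift columns)
  \<comment> \<open>By orthogonality the products of the two rows are balanced on the m - 2
    remaining columns, so either sign c takes half of them.\<close>
  have "2 * card {k \<in> ?K. h ?i k * h ?j k = c} = card ?K"
  proof (rule card_sign_eq)
    show "h ?i k * h ?j k = 1 \<or> h ?i k * h ?j k = -1" if "k \<in> ?K" for k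
      using that sign[OF i, of k] sign[OF j, of k] by auto
  qed (use c orthogonal[OF i j row] in auto)
  moreover have "card ?K = m - 2" using i j row by (subst card_Diff_subset) auto
  ultimately show ?thesis using eq by linarith
qed

lemma dominates_cover: "x \<rightarrow>\<^bsub>cover\<^esub> y \<longleftrightarrow> arc x y"
  by (force simp: cover_def arcs_ends_def arc_to_ends_def)

lemma directed_deza_graph_cover:
  "directed_deza_graph cover (2 * m) (m - 1) (m - 1) (m div 2 - 1) 0"
proof
  have "{(x, y). arc x y} \<subseteq> {..<2 * m} \<times> {..<2 * m}" by (auto simp: arc_def)
  then show "finite (arcs cover)"
    by (auto simp: cover_def intro: finite_subset)
next
  fix x assume "x \<in> verts cover"
  then have x: "x < 2 * m" by (simp add: cover_def)
  have "in_arcs cover x = (\<lambda>w. (w, x)) ` {w. arc w x}"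
    by (auto simp: in_arcs_def cover_def)
  then show "in_degree cover x = m - 1"
    using card_in[OF x] by (simp add: in_degree_def card_image inj_on_def)
  have "out_arcs cover x = (\<lambda>w. (x, w)) ` {w. arc x w}"
    by (auto simp: out_arcs_def cover_def)
  then show "out_degree cover x = m - 1"
    using card_out[OF x] by (simp add: out_degree_def card_image inj_on_def)
  have "{y \<in> verts cover. adjacent cover x y} = {}"
    using arc_asym by (auto simp: adjacent_def dominates_cover)
  then show "card {y \<in> verts cover. adjacent cover x y} = 0" by (simp only: card.empty)
  fix y assume "y \<in> verts cover" and "x \<noteq> y"
  then have y: "y < 2 * m" by (simp add: cover_def)
  have "{w \<in> verts cover. x \<rightarrow>\<^bsub>cover\<^esub> w \<and> w \<rightarrow>\<^bsub>cover\<^esub> y} = {w. arc x w \<and> arc w y}"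
    unfolding dominates_cover by (auto simp: cover_def arc_def)
  \<comment> \<open>The value b = m - 1 comes from two vertices of one row, the value a from
    different rows.\<close>
  then show "card {w \<in> verts cover. x \<rightarrow>\<^bsub>cover\<^esub> w \<and> w \<rightarrow>\<^bsub>cover\<^esub> y} \<in> {m div 2 - 1, m - 1}"
    using card_two_paths_same_row[OF x y \<open>x \<noteq> y\<close>] card_two_paths_distinct_rows[OF x y] by auto
\<comment> \<open>Loops are impossible because arcs join distinct rows, and parallel arcs because an
  arc is the pair of its ends.\<close>
qed (auto simp: cover_def arc_def arc_to_ends_def)

end

lemma skew_orthogonal_signs_of_skew_hadamard:
  assumes "skew_hadamard_matrix m H"
  shows "skew_orthogonal_signs m (\<lambda>i j. H $$ (i, j))"
proof -
  have H: "H \<in> carrier_mat m m" and el: "elements_mat H \<subseteq> {1, -1}"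
    and HHt: "H * transpose_mat H = of_nat m \<cdot>\<^sub>m 1\<^sub>m m"
    and HplusHt: "H + transpose_mat H = 2 \<cdot>\<^sub>m 1\<^sub>m m"
    using assms unfolding skew_hadamard_matrix_def hadamard_matrix_def by auto
  \<comment> \<open>The case i = j makes the diagonal entries 1; the other case is skewness.\<close>
  have plus: "H $$ (i, j) + H $$ (j, i) = (if i = j then 2 else 0)" if "i < m" "j < m" for i j
    using arg_cong[OF HplusHt, of "\<lambda>M. M $$ (i, j)"] that H by auto
  show ?thesis
  proof
    show "H $$ (i, j) = 1 \<or> H $$ (i, j) = -1" if "i < m" "j < m" for i j
      using elements_matI[OF H that refl] el by auto
    show "H $$ (j, i) = - H $$ (i, j)" if "i < m" "j < m" "i \<noteq> j" for i j
      using plus[OF that(1,2)] that(3) by auto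
    show "(\<Sum>k\<in>{..<m} - {i, j}. H $$ (i, k) * H $$ (j, k)) = 0"
      if i: "i < m" and j: "j < m" and "i \<noteq> j" for i j
    proof -
      let ?f = "\<lambda>k. H $$ (i, k) * H $$ (j, k)"
      have "(\<Sum>k<m. ?f k) = 0"
        using arg_cong[OF HHt, of "\<lambda>M. M $$ (i, j)"] that H
        by (auto simp: scalar_prod_def lessThan_atLeast0)
      moreover have "(\<Sum>k<m. ?f k) = (\<Sum>k\<in>{..<m} - {i, j}. ?f k) + (\<Sum>k\<in>{i, j}. ?f k)"
        using i j by (intro sum.subset_diff) auto
      \<comment> \<open>With unit diagonal the two terms are the entries (j, i) and (i, j), which
        cancel by skewness. Hence dropping these columns keeps the sum zero.\<close>
      moreover have "(\<Sum>k\<in>{i, j}. ?f k) = 0"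
        using plus[OF i i] plus[OF j j] plus[OF i j] \<open>i \<noteq> j\<close> by simp
      ultimately show ?thesis by simp
    qed
  qed
qed

theorem theorem3p8:
  fixes u :: nat and H :: "int mat"
  assumes "u \<ge> 1" and "skew_hadamard_matrix (4 * u) H"
  shows "\<exists>D :: (nat, nat \<times> nat) pre_digraph.
    directed_deza_graph D (8 * u) (4 * u - 1) (4 * u - 1) (2 * u - 1) 0"
proof -
  interpret skew_orthogonal_signs "4 * u" "\<lambda>i j. H $$ (i, j)"
    using assms(2) by (rule skew_orthogonal_signs_of_skew_hadamard)
  have "4 * u div 2 = 2 * u" "2 * (4 * u) = 8 * u" by simp_all
  with directed_deza_graph_cover show ?thesis by metis
qed

end
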